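(* Let $p$ be a prime, let $a,b,c,d\in\mathbb{F}_p\setminus\{0\}$, and let $T_f:\mathbb{F}_p^{\Gamma^2}\to\mathbb{F}_p^{\Gamma^2}$ be the linear cellular automaton with coefficients $a,b,c,d$ on the Cayley tree $\Gamma^2$ of order two over the field $\mathbb{F}_p$. Let $\mu_\pi$ be the uniform Bernoulli measure on $\mathbb{F}_p^{\Gamma^2}$, and assume that $a,b,c,d$ are chosen such that $T_f$ preserves $\mu_\pi$. Then the measure-theoretical entropy of $T_f$ with respect to $\mu_\pi$ is infinite: $h_{\mu_\pi}(T_f)=\infty$.
   Context: The Cayley tree $\Gamma^2$ of order two is the infinite tree, with vertex set $V$, in which every vertex has exactly three neighbours; a root $x_0$ is fixed. The three neighbours of the root are labelled $x_1,x_2,x_3$. Every non-root vertex $x_w$ is labelled by a word $w$ with first letter in $\{1,2,3\}$ and all other letters in $\{1,2\}$; its two children are $x_{w1}$ and $x_{w2}$, and its parent is obtained by deleting the last letter of $w$ (the parent of $x_1,x_2,x_3$ is $x_0$). $\mathbb{F}_p^{\Gamma^2}=\mathbb{F}_p^{V}$ is the set of all configurations $V\to\mathbb{F}_p$, with the product $\sigma$-algebra. The cellular automaton $T_f$ with coefficients $a,b,c,d$ maps a configuration $(x_v^{(t)})_{v\in V}$ to $(x_v^{(t+1)})_{v\in V}$, where for the root $$x_0^{(t+1)}=a x_1^{(t)}+b x_2^{(t)}+c x_3^{(t)}+d x_0^{(t)} \pmod p,$$ and for a non-root vertex $x_w$ with parent $x_{w'}$ $$x_w^{(t+1)}=a x_{w1}^{(t)}+b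 x_{w2}^{(t)}+c x_{w'}^{(t)}+d x_w^{(t)} \pmod p.$$ The uniform Bernoulli measure $\mu_\pi$ on $\mathbb{F}_p^{V}$ is the product measure giving each state of $\mathbb{F}_p$ probability $1/p$ at each vertex (so a cylinder fixing the states of $k$ vertices has measure $p^{-k}$). For a measure-preserving system $(X,\mathcal{B},\mu,T)$ and a measurable partition $\alpha$ of $X$, the entropy of $\alpha$ is $H_\mu(\alpha)=-\sum_{A\in\alpha}\mu(A)\log\mu(A)$ (logarithm to base 2). For $H_\mu(\alpha)<\infty$, put $h_\mu(T,\alpha)=\lim_{n\to\infty}\frac1n H_\mu\big(\bigvee_{i=0}^{n-1}T^{-i}\alpha\big)$, where $\vee$ denotes the common refinement of partitions. The measure-theoretical entropy is $h_\mu(T)=\sup\{h_\mu(T,\alpha): \alpha \text{ a partition with } H_\mu(\alpha)<\infty\}$. *)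

theory Defs
  imports "HOL-Probability.Probability" "HOL-Library.Disjoint_Sets"
begin

section \<open>Entropy of a measure-preserving transformation\<close>

definition measure_preserving :: "'a measure \<Rightarrow> ('a \<Rightarrow> 'a) \<Rightarrow> bool" where
  "measure_preserving M T \<longleftrightarrow>
     T \<in> measurable M M \<and> (\<forall>A\<in>sets M. emeasure M (T -` A \<inter> space M) = emeasure M A)"

text \<open>Partitions are countable, as is standard for the entropy of a partition; in particular
  every finite partition into measurable sets is included.\<close>

definition measurable_partition :: "'a measure \<Rightarrow> 'a set set \<Rightarrow> bool" where
  "measurable_partition M \<alpha> \<longleftrightarrow> partition_on (space M) \<alpha> \<and> \<alpha> \<subseteq> sets M \<and> countable \<alpha>"

text \<open>For a probability measure every summand is nonnegative, so that \<^const>\<open>ennreal\<close> loses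
  nothing, and a null set contributes \<open>0\<close>. The sum may be infinite.\<close>

definition partition_entropy :: "'a measure \<Rightarrow> 'a set set \<Rightarrow> ennreal" where
  "partition_entropy M \<alpha> =
     (\<Sum>\<^sub>\<infinity>A\<in>\<alpha>. ennreal (- (measure M A * log 2 (measure M A))))"

text \<open>Empty preimages are dropped, so that the result is again a partition of the space.\<close>

definition preimage_partition :: "'a measure \<Rightarrow> ('a \<Rightarrow> 'a) \<Rightarrow> 'a set set \<Rightarrow> 'a set set" where
  "preimage_partition M T \<alpha> = (\<lambda>A. T -` A \<inter> space M) ` \<alpha> - {{}}"

definition iterated_join :: "'a measure \<Rightarrow> ('a \<Rightarrow> 'a) \<Rightarrow> 'a set set \<Rightarrow> nat \<Rightarrow> 'a set set" where
  "iterated_join M T \<alpha> n = common_refinement ((\<lambda>i. preimage_partition M (T ^^ i) \<alpha>) ` {..<n})"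

definition entropy_wrt_partition :: "'a measure \<Rightarrow> ('a \<Rightarrow> 'a) \<Rightarrow> 'a set set \<Rightarrow> ennreal" where
  "entropy_wrt_partition M T \<alpha> =
     lim (\<lambda>n. partition_entropy M (iterated_join M T \<alpha> n) / of_nat n)"

definition measure_entropy :: "'a measure \<Rightarrow> ('a \<Rightarrow> 'a) \<Rightarrow> ennreal" where
  "measure_entropy M T =
     (SUP \<alpha>\<in>{\<alpha>. measurable_partition M \<alpha> \<and> partition_entropy M \<alpha> < \<infinity>}.
        entropy_wrt_partition M T \<alpha>)"

section \<open>The linear cellular automaton on the Cayley tree of order two\<close>

text \<open>A vertex is identified with the word labelling it, the root with the empty word.
  The neighbours of \<open>w\<close> are \<open>butlast w\<close> and the words \<open>w @ [i]\<close> in the set.\<close>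

definition cayley_vertices :: "nat list set" where
  "cayley_vertices = {[]} \<union> {k # w | k w. k \<in> {1, 2, 3} \<and> set w \<subseteq> {1, 2}}"

text \<open>Elements of the prime field are represented by the residues \<open>0, \<dots>, p - 1\<close>, and
  configurations by functions that are \<^const>\<open>undefined\<close> outside the vertex set.\<close>

definition configurations :: "nat \<Rightarrow> (nat list \<Rightarrow> nat) set" where
  "configurations p = (\<Pi>\<^sub>E v\<in>cayley_vertices. {0..<p})"

definition cayley_CA ::
    "nat \<Rightarrow> nat \<Rightarrow> nat \<Rightarrow> nat \<Rightarrow> nat \<Rightarrow> (nat list \<Rightarrow> nat) \<Rightarrow> (nat list \<Rightarrow> nat)" where
  "cayley_CA p a b c d x =
     (\<lambda>w\<in>cayley_vertices.
        if w = [] then (a * x [1] + b * x [2] + c * x [3] + d * x []) mod p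
        else (a * x (w @ [1]) + b * x (w @ [2]) + c * x (butlast w) + d * x w) mod p)"

definition uniform_bernoulli :: "nat \<Rightarrow> (nat list \<Rightarrow> nat) measure" where
  "uniform_bernoulli p = (\<Pi>\<^sub>M v\<in>cayley_vertices. uniform_count_measure {0..<p})"

lemma space_uniform_bernoulli: "space (uniform_bernoulli p) = configurations p"
  by (simp add: uniform_bernoulli_def configurations_def space_PiM space_uniform_count_measure)

lemma cayley_CA_in_configurations:
  assumes "p > 0"
  shows "cayley_CA p a b c d x \<in> configurations p"
  using assms by (auto simp: cayley_CA_def configurations_def)

end

theory Submission
  imports Defs "HOL-Number_Theory.Cong"
begin

text \<open>
  At every step a vertex receives the states of its children, so a set of vertices on one level
  keeps receiving fresh independent digits from ever deeper levels. Fix a finite set \<open>W\<close> of vertices that all lie on one level \<open>l \<ge> 1\<close>, and partition the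
  configurations according to their states on \<open>W\<close>. After \<open>i\<close> steps the state at \<open>w \<in> W\<close> is a linear
  form in the initial states up to level \<open>l + i\<close>, and the vertices on level \<open>l + i\<close> on which it
  depends are descendants of \<open>w\<close>; the vertex \<open>w1\<dots>1\<close> occurs with the invertible coefficient \<open>a ^ i\<close>.
  These vertices are distinct for distinct pairs \<open>(i, w)\<close>, so the system of all the forms with
  \<open>i < n\<close> and \<open>w \<in> W\<close> is triangular, and every family of values for them is attained
  (\<open>observations_solvable\<close>).

  The joint fibres of these forms are the atoms of the iterated join. The automaton is additive and
  the uniform measure is invariant under translations (\<open>distr_translate\<close>), and a translation by \<open>z\<close>
  carries the zero fibre to the fibre through \<open>z\<close>. Hence all \<open>p ^ (|W| n)\<close> atoms have the same
  measure (\<open>observation_fibres_equidistributed\<close>), the join has entropy \<open>n |W| log p\<close>, and the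
  automaton has entropy exactly \<open>|W| log p\<close> with respect to this partition. As the levels of the tree grow
  exponentially, \<open>|W|\<close> is unbounded, so the entropy is infinite.
\<close>

section \<open>Partitions into fibres\<close>

definition fibre_partition :: "('a \<Rightarrow> 'b) \<Rightarrow> 'a set \<Rightarrow> 'a set set" where
  "fibre_partition f S = (\<lambda>x. {y \<in> S. f y = f x}) ` S"

lemma partition_on_fibre_partition: "partition_on S (fibre_partition f S)"
  by (auto simp: fibre_partition_def partition_on_def disjoint_def)

lemma card_fibre_partition: "card (fibre_partition f S) = card (f ` S)"
proof -
  have "bij_betw (\<lambda>v. {y \<in> S. f y = v}) (f ` S) (fibre_partition f S)"
    by (auto simp: bij_betw_def inj_on_def fibre_partition_def)
  then show ?thesis
    by (simp add: bij_betw_same_card)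
qed

lemma finite_fibre_partition: "finite (f ` S) \<Longrightarrow> finite (fibre_partition f S)"
proof -
  assume "finite (f ` S)"
  then have "finite ((\<lambda>v. {y \<in> S. f y = v}) ` f ` S)"
    by blast
  then show ?thesis
    by (simp add: fibre_partition_def image_image)
qed

lemma preimage_fibre_partition:
  assumes g: "g \<in> space M \<rightarrow> space M"
  shows "preimage_partition M g (fibre_partition f (space M)) = fibre_partition (\<lambda>x. f (g x)) (space M)"
proof (intro equalityI subsetI)
  fix X assume "X \<in> preimage_partition M g (fibre_partition f (space M))"
  then obtain x where X: "X = g -` {y \<in> space M. f y = f x} \<inter> space M" and "X \<noteq> {}"
    by (auto simp: preimage_partition_def fibre_partition_def)
  then obtain z where z: "z \<in> X"
    by blast
  then have "X = {y \<in> space M. f (g y) = f (g z)}" "z \<in> space M"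
    using g X by auto
  then show "X \<in> fibre_partition (\<lambda>x. f (g x)) (space M)"
    by (auto simp: fibre_partition_def)
next
  fix X assume "X \<in> fibre_partition (\<lambda>x. f (g x)) (space M)"
  then obtain x where x: "x \<in> space M" and X: "X = {y \<in> space M. f (g y) = f (g x)}"
    by (auto simp: fibre_partition_def)
  have "X = g -` {y \<in> space M. f y = f (g x)} \<inter> space M"
    using g X by auto
  moreover have "g x \<in> space M" "X \<noteq> {}"
    using g x X by auto
  ultimately show "X \<in> preimage_partition M g (fibre_partition f (space M))"
    unfolding preimage_partition_def fibre_partition_def by blast
qed

text \<open>A block of the refinement is an intersection of fibres, one for each index; once it
  contains a point \<open>x\<close>, every one of them must be the fibre through \<open>x\<close>, so that the intersection is
  the fibre of the tuple. Indices that yield the same partition also receive the same fibre.\<close>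

lemma common_refinement_fibre_partitions:
  assumes "I \<noteq> {}"
  shows "common_refinement ((\<lambda>i. fibre_partition (g i) S) ` I) =
           fibre_partition (\<lambda>x. \<lambda>i\<in>I. g i x) S"
proof -
  define P where "P = (\<lambda>i. fibre_partition (g i) S)"
  have joint: "{y \<in> S. (\<lambda>i\<in>I. g i y) = (\<lambda>i\<in>I. g i x)} = (\<Inter>i\<in>I. {y \<in> S. g i y = g i x})" for x
    using assms by (auto simp: restrict_def fun_eq_iff)
  have block: "B = {y \<in> S. g i y = g i x}" if "B \<in> P i" "x \<in> B" for B i x
    using that by (auto simp: P_def fibre_partition_def)
  show ?thesis
    unfolding P_def[symmetric]
  proof (intro equalityI subsetI)
    fix X assume "X \<in> common_refinement (P ` I)"
    then obtain F where F: "\<And>i. i \<in> I \<Longrightarrow> F (P i) \<in> P i" and X: "X = \<Inter> (F ` P ` I)" and "X \<noteq> {}"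
      by (auto simp: common_refinement Pi_iff)
    then obtain x where x: "x \<in> X"
      by blast
    have eq: "F (P i) = {y \<in> S. g i y = g i x}" if "i \<in> I" for i
      using block[OF F[OF that]] x X that by blast
    have "X = (\<Inter>i\<in>I. {y \<in> S. g i y = g i x})"
      unfolding X image_image using eq by auto
    moreover have "x \<in> S"
      using x assms calculation by auto
    ultimately show "X \<in> fibre_partition (\<lambda>x. \<lambda>i\<in>I. g i x) S"
      unfolding fibre_partition_def joint by blast
  next
    fix X assume "X \<in> fibre_partition (\<lambda>x. \<lambda>i\<in>I. g i x) S"
    then obtain x where x: "x \<in> S" and X: "X = (\<Inter>i\<in>I. {y \<in> S. g i y = g i x})"
      unfolding fibre_partition_def joint by blast
    \<comment> \<open>The choice function must depend on the partition alone, since its index may not be unique.\<close>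
    define F where "F = (\<lambda>Q. \<Union>{B \<in> Q. x \<in> B})"
    have F: "F (P i) = {y \<in> S. g i y = g i x}" for i
      using x by (auto simp: F_def P_def fibre_partition_def)
    have "F \<in> (\<Pi> Q\<in>P ` I. Q)"
      using x by (auto simp: F) (auto simp: P_def fibre_partition_def)
    moreover have "X = \<Inter> (F ` P ` I)"
      by (simp add: X F image_image)
    moreover have "x \<in> X"
      using x X by auto
    ultimately show "X \<in> common_refinement (P ` I)"
      unfolding common_refinement by blast
  qed
qed

lemma iterated_join_fibre_partition:
  assumes T: "T \<in> space M \<rightarrow> space M" and "n > 0"
  shows "iterated_join M T (fibre_partition f (space M)) n =
           fibre_partition (\<lambda>x. \<lambda>i\<in>{..<n}. f ((T ^^ i) x)) (space M)"
proof -
  have "T ^^ i \<in> space M \<rightarrow> space M" for i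
    using T by (induction i) auto
  then have "iterated_join M T (fibre_partition f (space M)) n =
      common_refinement ((\<lambda>i. fibre_partition (\<lambda>x. f ((T ^^ i) x)) (space M)) ` {..<n})"
    by (simp add: iterated_join_def preimage_fibre_partition)
  also have "\<dots> = fibre_partition (\<lambda>x. \<lambda>i\<in>{..<n}. f ((T ^^ i) x)) (space M)"
    using \<open>n > 0\<close> by (intro common_refinement_fibre_partitions) auto
  finally show ?thesis .
qed

lemma (in prob_space) partition_entropy_equidistributed:
  assumes part: "partition_on (space M) \<alpha>" and fin: "finite \<alpha>" and sets: "\<alpha> \<subseteq> sets M"
    and eq: "\<And>A. A \<in> \<alpha> \<Longrightarrow> prob A = r"
  shows "partition_entropy M \<alpha> = ennreal (log 2 (card \<alpha>))"
proof -
  have "1 = prob (\<Union>A\<in>\<alpha>. A)"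
    using part prob_space by (simp add: partition_on_def)
  also have "\<dots> = (\<Sum>A\<in>\<alpha>. prob A)"
    using part fin sets
    by (intro finite_measure_finite_Union) (auto simp: partition_on_def disjoint_def disjoint_family_on_def)
  finally have r: "card \<alpha> * r = 1"
    using eq by simp
  then have pos: "card \<alpha> > 0"
    by (metis mult_zero_left of_nat_0 gr0I zero_neq_one)
  with r have r': "r = 1 / card \<alpha>"
    by (simp add: field_simps)
  have "partition_entropy M \<alpha> = (\<Sum>A\<in>\<alpha>. ennreal (log 2 (card \<alpha>) / card \<alpha>))"
    unfolding partition_entropy_def using fin pos
    by (simp add: eq r' log_divide cong: sum.cong)
  also have "\<dots> = ennreal (card \<alpha> * (log 2 (card \<alpha>) / card \<alpha>))"
    by (simp add: ennreal_mult' ennreal_of_nat_eq_real_of_nat del: times_divide_eq_right)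
  finally show ?thesis
    using pos by simp
qed

section \<open>Translations of the configuration space\<close>

definition translate :: "nat \<Rightarrow> (nat list \<Rightarrow> nat) \<Rightarrow> (nat list \<Rightarrow> nat) \<Rightarrow> nat list \<Rightarrow> nat" where
  "translate p z x = (\<lambda>v\<in>cayley_vertices. (x v + z v) mod p)"

lemma translate_apply: "v \<in> cayley_vertices \<Longrightarrow> translate p z x v = (x v + z v) mod p"
  by (simp add: translate_def)

lemma configuration_less: "x \<in> configurations p \<Longrightarrow> v \<in> cayley_vertices \<Longrightarrow> x v < p"
  by (auto simp: configurations_def PiE_iff)

lemma translate_in_configurations: "p > 0 \<Longrightarrow> translate p z x \<in> configurations p"
  by (auto simp: translate_def configurations_def)

lemma card_shifted_residues:
  fixes p k :: nat
  assumes "A \<subseteq> {0..<p}"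
  shows "card {r \<in> {0..<p}. (r + k) mod p \<in> A} = card A"
proof -
  have inj: "inj_on (\<lambda>r. (r + k) mod p) {0..<p}"
  proof (rule inj_onI)
    fix r s assume rs: "r \<in> {0..<p}" "s \<in> {0..<p}" and "(r + k) mod p = (s + k) mod p"
    then have "[r = s] (mod p)"
      by (simp only: cong_def[symmetric] cong_add_rcancel_nat)
    with rs show "r = s"
      by (simp add: cong_less_modulus_unique_nat)
  qed
  moreover have "(\<lambda>r. (r + k) mod p) ` {0..<p} \<subseteq> {0..<p}"
    by auto
  ultimately have surj: "(\<lambda>r. (r + k) mod p) ` {0..<p} = {0..<p}"
    by (intro card_subset_eq) (auto simp: card_image)
  have "bij_betw (\<lambda>r. (r + k) mod p) {r \<in> {0..<p}. (r + k) mod p \<in> A} A"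
    unfolding bij_betw_def
  proof
    show "inj_on (\<lambda>r. (r + k) mod p) {r \<in> {0..<p}. (r + k) mod p \<in> A}"
      using inj by (rule inj_on_subset) auto
    show "(\<lambda>r. (r + k) mod p) ` {r \<in> {0..<p}. (r + k) mod p \<in> A} = A"
    proof (intro equalityI subsetI)
      fix y assume "y \<in> A"
      moreover from this obtain r where "r \<in> {0..<p}" "y = (r + k) mod p"
        using surj assms by blast
      ultimately show "y \<in> (\<lambda>r. (r + k) mod p) ` {r \<in> {0..<p}. (r + k) mod p \<in> A}"
        by blast
    qed auto
  qed
  then show ?thesis
    by (rule bij_betw_same_card)
qed

lemma prob_space_uniform_bernoulli: "p > 0 \<Longrightarrow> prob_space (uniform_bernoulli p)"
  unfolding uniform_bernoulli_def
  by (intro prob_space_PiM prob_space_uniform_count_measure) auto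

lemma measurable_translate:
  assumes "p > 0"
  shows "translate p z \<in> measurable (uniform_bernoulli p) (uniform_bernoulli p)"
  unfolding translate_def[abs_def] uniform_bernoulli_def
proof (rule measurable_restrict)
  fix v assume v: "v \<in> cayley_vertices"
  have "(\<lambda>r. (r + z v) mod p) \<in>
          measurable (uniform_count_measure {0..<p}) (uniform_count_measure {0..<p})"
    using assms by (auto simp: measurable_def space_uniform_count_measure sets_uniform_count_measure)
  from measurable_compose[OF measurable_component_singleton[OF v] this]
  show "(\<lambda>x. (x v + z v) mod p) \<in> measurable
     (Pi\<^sub>M cayley_vertices (\<lambda>v. uniform_count_measure {0..<p})) (uniform_count_measure {0..<p})"
    by simp
qed

text \<open>Shifting a residue modulo \<open>p\<close> is a bijection, so every cylinder is pulled back to a cylinder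
  with sides of the same cardinalities; cylinders determine the product measure.\<close>

lemma distr_translate:
  assumes "p > 0"
  shows "distr (uniform_bernoulli p) (uniform_bernoulli p) (translate p z) = uniform_bernoulli p"
proof -
  let ?U = "\<lambda>_::nat list. uniform_count_measure {0..<p}"
  interpret U: prob_space "?U v" for v
    using assms by (intro prob_space_uniform_count_measure) auto
  interpret product_prob_space ?U cayley_vertices
    by unfold_locales
  have M: "uniform_bernoulli p = Pi\<^sub>M cayley_vertices ?U"
    by (simp add: uniform_bernoulli_def)
  show ?thesis
    unfolding M
  proof (rule PiM_eq)
    fix J F assume J: "finite J" "J \<subseteq> cayley_vertices" and F: "\<And>j. j \<in> J \<Longrightarrow> F j \<in> sets (?U j)"
    then have F': "F j \<subseteq> {0..<p}" if "j \<in> J" for j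
      using that by (auto simp: sets_uniform_count_measure)
    define G where "G j = {r \<in> {0..<p}. (r + z j) mod p \<in> F j}" for j
    have pre: "translate p z -` prod_emb cayley_vertices ?U J (Pi\<^sub>E J F) \<inter> space (Pi\<^sub>M cayley_vertices ?U)
        = prod_emb cayley_vertices ?U J (Pi\<^sub>E J G)"
      using J assms
      by (auto simp: prod_emb_def space_PiM translate_def PiE_iff space_uniform_count_measure G_def
          extensional_def subset_eq)
    have "emeasure (distr (Pi\<^sub>M cayley_vertices ?U) (Pi\<^sub>M cayley_vertices ?U) (translate p z))
            (prod_emb cayley_vertices ?U J (Pi\<^sub>E J F)) =
          emeasure (Pi\<^sub>M cayley_vertices ?U) (prod_emb cayley_vertices ?U J (Pi\<^sub>E J G))"
      using measurable_translate[OF assms, of z] J F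
      by (subst emeasure_distr) (auto simp: M pre)
    also have "\<dots> = (\<Prod>j\<in>J. emeasure (?U j) (G j))"
      using J by (intro emeasure_PiM_emb) (auto simp: G_def sets_uniform_count_measure)
    also have "\<dots> = (\<Prod>j\<in>J. emeasure (?U j) (F j))"
    proof (rule prod.cong)
      fix j assume "j \<in> J"
      have "G j \<subseteq> {0..<p}" by (auto simp: G_def)
      with F'[OF \<open>j \<in> J\<close>] show "emeasure (?U j) (G j) = emeasure (?U j) (F j)"
        by (simp only: emeasure_uniform_count_measure finite_atLeastLessThan G_def card_shifted_residues)
    qed simp
    finally show "emeasure (distr (Pi\<^sub>M cayley_vertices ?U) (Pi\<^sub>M cayley_vertices ?U) (translate p z))
            (prod_emb cayley_vertices ?U J (Pi\<^sub>E J F)) = (\<Prod>j\<in>J. emeasure (?U j) (F j))" .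
  qed simp
qed

section \<open>Linearity and locality of the automaton\<close>

lemma root_in_vertices: "[] \<in> cayley_vertices"
  and root_child_in_vertices: "i \<in> {1, 2, 3} \<Longrightarrow> [i] \<in> cayley_vertices"
  by (auto simp: cayley_vertices_def)

lemma child_in_vertices:
  "w \<in> cayley_vertices \<Longrightarrow> w \<noteq> [] \<Longrightarrow> i \<in> {1, 2} \<Longrightarrow> w @ [i] \<in> cayley_vertices"
  by (auto simp: cayley_vertices_def)

lemma parent_in_vertices: "w \<in> cayley_vertices \<Longrightarrow> butlast w \<in> cayley_vertices"
  by (cases w) (fastforce simp: cayley_vertices_def dest: in_set_butlastD)+

lemmas vertices_intros =
  root_in_vertices root_child_in_vertices child_in_vertices parent_in_vertices

locale cayley_automaton =
  fixes p a b c d :: nat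
  assumes p_gt_1: "p > 1" and coprime_a: "coprime a p"
begin

abbreviation T where "T \<equiv> cayley_CA p a b c d"

lemma p_pos: "p > 0"
  using p_gt_1 by simp

lemma T_pow_in_configurations: "x \<in> configurations p \<Longrightarrow> (T ^^ i) x \<in> configurations p"
  by (cases i) (auto intro: cayley_CA_in_configurations p_pos)

lemma T_root: "T x [] = (a * x [1] + b * x [2] + c * x [3] + d * x []) mod p"
  by (simp add: cayley_CA_def root_in_vertices)

lemma T_nonroot:
  assumes "w \<in> cayley_vertices" "w \<noteq> []"
  shows "T x w = (a * x (w @ [1]) + b * x (w @ [2]) + c * x (butlast w) + d * x w) mod p"
  using assms by (simp add: cayley_CA_def)

lemma T_translate: "T (translate p z x) = translate p (T z) (T x)"
proof
  fix w
  have add: "(a * ((x1 + z1) mod p) + b * ((x2 + z2) mod p) + c * ((x3 + z3) mod p)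
          + d * ((x4 + z4) mod p)) mod p
      = ((a * x1 + b * x2 + c * x3 + d * x4) mod p
          + (a * z1 + b * z2 + c * z3 + d * z4) mod p) mod p"
    for x1 x2 x3 x4 z1 z2 z3 z4
  proof -
    have "[a * ((x1 + z1) mod p) + b * ((x2 + z2) mod p) + c * ((x3 + z3) mod p)
          + d * ((x4 + z4) mod p)
      = a * (x1 + z1) + b * (x2 + z2) + c * (x3 + z3) + d * (x4 + z4)] (mod p)"
      by (intro cong_add cong_mult cong_refl cong_mod_leftI)
    also have "a * (x1 + z1) + b * (x2 + z2) + c * (x3 + z3) + d * (x4 + z4) =
        (a * x1 + b * x2 + c * x3 + d * x4) + (a * z1 + b * z2 + c * z3 + d * z4)"
      by (simp add: algebra_simps)
    finally show ?thesis
      by (simp only: cong_def mod_add_eq)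
  qed
  show "T (translate p z x) w = translate p (T z) (T x) w"
  proof (cases "w \<in> cayley_vertices")
    case w: True
    show ?thesis
    proof (cases "w = []")
      case True
      have "[1] \<in> cayley_vertices" "[2] \<in> cayley_vertices" "[3] \<in> cayley_vertices"
        by (auto intro: root_child_in_vertices)
      then show ?thesis
        by (simp only: True translate_apply root_in_vertices T_root add)
    next
      case False
      then have "w @ [1] \<in> cayley_vertices" "w @ [2] \<in> cayley_vertices" "butlast w \<in> cayley_vertices"
        using w by (auto intro: child_in_vertices parent_in_vertices)
      then show ?thesis
        by (simp only: w T_nonroot[OF w False] translate_apply add)
    qed
  qed (simp add: cayley_CA_def translate_def)
qed

lemma T_pow_translate: "(T ^^ i) (translate p z x) = translate p ((T ^^ i) z) ((T ^^ i) x)"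
  by (induction i) (simp_all add: T_translate)

lemma T_local:
  assumes "\<And>v. v \<in> cayley_vertices \<Longrightarrow> length v \<le> Suc (length w) \<Longrightarrow> x v = y v"
  shows "T x w = T y w"
  using assms by (simp add: cayley_CA_def vertices_intros)

definition vanishes_below :: "nat \<Rightarrow> (nat list \<Rightarrow> nat) \<Rightarrow> bool" where
  "vanishes_below l x \<longleftrightarrow> (\<forall>v\<in>cayley_vertices. length v < l \<longrightarrow> x v = 0)"

lemma vanishes_below_T:
  assumes "vanishes_below (Suc l) x"
  shows "vanishes_below l (T x)"
  using assms by (auto simp: vanishes_below_def cayley_CA_def vertices_intros)

lemma vanishes_below_T_pow:
  assumes "vanishes_below (l + i) x"
  shows "vanishes_below l ((T ^^ i) x)"
  using assms by (induction i arbitrary: l) (auto intro: vanishes_below_T)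

section \<open>Prescribing the values observed in a window\<close>

text \<open>To hit a target on level \<open>l\<close>, it suffices to use one child of every vertex: the value \<open>y w\<close>,
  divided by the coefficient \<open>a\<close>, is placed at \<open>w1\<close>, and the other child carries \<open>0\<close>. As the
  target vanishes on the levels above, the solution vanishes up to level \<open>l\<close>, so that the terms for
  the parent and the vertex itself disappear.\<close>

lemma T_solve:
  assumes y: "y \<in> configurations p" and van: "vanishes_below l y" and l: "l \<ge> 1"
  obtains x where "x \<in> configurations p" "vanishes_below (Suc l) x"
    "\<And>w. w \<in> cayley_vertices \<Longrightarrow> length w \<le> l \<Longrightarrow> T x w = y w"
proof -
  obtain a' where a': "[a * a' = 1] (mod p)"
    using cong_solve_coprime_nat[OF coprime_a] by auto
  define x where "x = (\<lambda>v\<in>cayley_vertices.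
     if last v = 1 then (a' * y (butlast v)) mod p else 0)"
  have x: "x \<in> configurations p"
    using p_pos by (auto simp: x_def configurations_def)
  have xvan: "vanishes_below (Suc l) x"
    unfolding vanishes_below_def
  proof (intro ballI impI)
    fix v assume v: "v \<in> cayley_vertices" "length v < Suc l"
    have "length (butlast v) < l"
      using v l by simp
    then have "y (butlast v) = 0"
      using van v(1) by (simp add: vanishes_below_def parent_in_vertices)
    with v(1) show "x v = 0"
      by (simp add: x_def)
  qed
  have "T x w = y w" if w: "w \<in> cayley_vertices" "length w \<le> l" for w
  proof (cases "w = []")
    case True
    have "x v = 0" if "length v \<le> 1" "v \<in> cayley_vertices" for v
      using that xvan l by (simp add: vanishes_below_def)
    then have "T x [] = 0"
      unfolding T_root by (simp add: root_in_vertices root_child_in_vertices)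
    moreover have "y [] = 0"
      using van l by (simp add: vanishes_below_def root_in_vertices)
    ultimately show ?thesis
      by (simp add: True)
  next
    case False
    have [simp]: "x (butlast w) = 0" "x w = 0"
      using xvan w by (auto simp: vanishes_below_def parent_in_vertices)
    have [simp]: "x (w @ [1]) = (a' * y w) mod p" "x (w @ [2]) = 0"
      using w False by (auto simp: x_def vertices_intros Suc_le_eq)
    have "T x w = (a * (a' * y w)) mod p"
      using w False by (simp add: cayley_CA_def mod_simps del: One_nat_def)
    also have "\<dots> = y w mod p"
      using cong_scalar_right[OF a', of "y w"] by (simp add: cong_def mult.assoc)
    also have "\<dots> = y w"
      using configuration_less[OF y w(1)] by simp
    finally show ?thesis .
  qed
  with x xvan show ?thesis
    using that by blast
qed

text \<open>The solution vanishes down to so deep a level that it takes \<open>n\<close> steps to reach level \<open>l\<close> at all: it can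
  prescribe the values at time \<open>n\<close> without disturbing those at earlier times.\<close>

lemma T_pow_solve:
  assumes "y \<in> configurations p" "vanishes_below l y" "l \<ge> 1"
  shows "\<exists>x\<in>configurations p. vanishes_below (l + n) x \<and>
    (\<forall>w\<in>cayley_vertices. length w \<le> l \<longrightarrow> (T ^^ n) x w = y w)"
  using assms
proof (induction n arbitrary: y l)
  case 0
  then show ?case by auto
next
  case (Suc n)
  obtain y' where y': "y' \<in> configurations p" "vanishes_below (Suc l) y'"
    "\<And>w. w \<in> cayley_vertices \<Longrightarrow> length w \<le> l \<Longrightarrow> T y' w = y w"
    using T_solve Suc.prems by metis
  obtain x where x: "x \<in> configurations p" "vanishes_below (Suc l + n) x"
    "\<And>w. w \<in> cayley_vertices \<Longrightarrow> length w \<le> Suc l \<Longrightarrow> (T ^^ n) x w = y' w"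
    using Suc.IH[OF y'(1,2)] by auto
  have "(T ^^ Suc n) x w = y w" if "w \<in> cayley_vertices" "length w \<le> l" for w
  proof -
    have "T ((T ^^ n) x) w = T y' w"
      using that x(3) by (intro T_local) auto
    with y'(3) that show ?thesis by simp
  qed
  with x show ?case by auto
qed

text \<open>The fibres of the observation are the atoms of the iterated join.\<close>

definition observation :: "nat list set \<Rightarrow> nat \<Rightarrow> (nat list \<Rightarrow> nat) \<Rightarrow> nat \<Rightarrow> nat list \<Rightarrow> nat" where
  "observation W n x = (\<lambda>i\<in>{..<n}. restrict ((T ^^ i) x) W)"

lemma observation_eq_iff:
  "observation W n x = observation W n y \<longleftrightarrow> (\<forall>i<n. \<forall>w\<in>W. (T ^^ i) x w = (T ^^ i) y w)"
  by (auto simp: observation_def fun_eq_iff restrict_def)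

text \<open>Induction on the number of times: a solution for the times before \<open>n\<close> is corrected at time \<open>n\<close>
  by adding a configuration that becomes visible on level \<open>l\<close> only at time \<open>n\<close>.\<close>

lemma observations_solvable:
  assumes W: "W \<subseteq> cayley_vertices" "\<And>w. w \<in> W \<Longrightarrow> length w = l" and l: "l \<ge> 1"
    and t: "\<And>i w. i < n \<Longrightarrow> w \<in> W \<Longrightarrow> t i w < p"
  shows "\<exists>x\<in>configurations p. \<forall>i<n. \<forall>w\<in>W. (T ^^ i) x w = t i w"
  using t
proof (induction n)
  case 0
  then show ?case
    using cayley_CA_in_configurations[OF p_pos] by blast
next
  case (Suc n)
  then obtain x where x: "x \<in> configurations p" "\<And>i w. i < n \<Longrightarrow> w \<in> W \<Longrightarrow> (T ^^ i) x w = t i w"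
    by (metis less_SucI)
  have range: "(T ^^ i) x w < p" if "w \<in> cayley_vertices" for i w
    using T_pow_in_configurations[OF x(1)] that by (rule configuration_less)
  \<comment> \<open>The error at time \<open>n\<close>; adding \<open>p\<close> keeps the subtraction of natural numbers exact.\<close>
  define y where "y = (\<lambda>v\<in>cayley_vertices.
     if v \<in> W then (t n v + (p - (T ^^ n) x v)) mod p else 0)"
  have "y \<in> configurations p"
    using p_pos by (auto simp: y_def configurations_def)
  moreover have "vanishes_below l y"
    using W by (auto simp: y_def vanishes_below_def)
  ultimately obtain e where e: "e \<in> configurations p" "vanishes_below (l + n) e"
    "\<And>w. w \<in> cayley_vertices \<Longrightarrow> length w \<le> l \<Longrightarrow> (T ^^ n) e w = y w"
    using T_pow_solve[of y l n] l by blast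
  have "(T ^^ i) (translate p e x) w = t i w" if "i < Suc n" "w \<in> W" for i w
  proof -
    have w: "w \<in> cayley_vertices" "length w = l"
      using W that by auto
    show ?thesis
    proof (cases "i = n")
      case True
      have "((T ^^ n) x w + (t n w + (p - (T ^^ n) x w)) mod p) mod p = (t n w + p) mod p"
        using range[OF w(1), of n] by (simp add: mod_simps)
      also have "\<dots> = t n w"
        using Suc.prems[of n w] that by simp
      finally show ?thesis
        using True w e(3)[of w] that by (simp add: T_pow_translate translate_apply y_def)
    next
      case False
      then have "vanishes_below (Suc l + (n - Suc i) + i) e"
        using e(2) that by simp
      then have "vanishes_below (Suc l + (n - Suc i)) ((T ^^ i) e)"
        by (rule vanishes_below_T_pow)
      then have "(T ^^ i) e w = 0"
        using w by (auto simp: vanishes_below_def)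
      then show ?thesis
        using w False that x(2)[of i w] range[OF w(1), of i]
        by (simp add: T_pow_translate translate_apply)
    qed
  qed
  then show ?case
    using translate_in_configurations[OF p_pos] by blast
qed

lemma observation_image:
  assumes W: "W \<subseteq> cayley_vertices" "\<And>w. w \<in> W \<Longrightarrow> length w = l" and l: "l \<ge> 1"
  shows "observation W n ` configurations p = (\<Pi>\<^sub>E i\<in>{..<n}. \<Pi>\<^sub>E w\<in>W. {0..<p})"
proof (intro equalityI subsetI)
  fix t assume "t \<in> observation W n ` configurations p"
  then show "t \<in> (\<Pi>\<^sub>E i\<in>{..<n}. \<Pi>\<^sub>E w\<in>W. {0..<p})"
    using T_pow_in_configurations W(1) by (fastforce simp: observation_def configurations_def PiE_iff)
next
  fix t assume t: "t \<in> (\<Pi>\<^sub>E i\<in>{..<n}. \<Pi>\<^sub>E w\<in>W. {0..<p})"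
  then have "\<exists>x\<in>configurations p. \<forall>i<n. \<forall>w\<in>W. (T ^^ i) x w = t i w"
    using W l by (intro observations_solvable) (auto simp: PiE_iff)
  then obtain x where x: "x \<in> configurations p" "\<And>i w. i < n \<Longrightarrow> w \<in> W \<Longrightarrow> (T ^^ i) x w = t i w"
    by blast
  have "t = observation W n x"
  proof
    fix i
    show "t i = observation W n x i"
      using t x by (cases "i < n") (auto simp: observation_def PiE_iff fun_eq_iff extensional_def)
  qed
  with x show "t \<in> observation W n ` configurations p"
    by blast
qed

lemma card_observation_image:
  assumes "finite W" "W \<subseteq> cayley_vertices" "\<And>w. w \<in> W \<Longrightarrow> length w = l" "l \<ge> 1"
  shows "card (observation W n ` configurations p) = p ^ (card W * n)"
    and "finite (observation W n ` configurations p)"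
  using assms by (simp_all add: observation_image card_PiE finite_PiE power_mult)

section \<open>Entropy of a window partition\<close>

lemma T_pow_measurable:
  assumes "T \<in> measurable (uniform_bernoulli p) (uniform_bernoulli p)"
  shows "T ^^ i \<in> measurable (uniform_bernoulli p) (uniform_bernoulli p)"
proof (induction i)
  case 0
  then show ?case by (simp add: id_def)
next
  case (Suc i)
  from measurable_comp[OF this assms] show ?case by (simp only: funpow.simps)
qed

lemma observation_fibre_measurable:
  assumes T: "T \<in> measurable (uniform_bernoulli p) (uniform_bernoulli p)"
    and W: "finite W" "W \<subseteq> cayley_vertices"
  shows "{x \<in> configurations p. \<forall>i<n. \<forall>w\<in>W. (T ^^ i) x w = k i w} \<in> sets (uniform_bernoulli p)"
proof -
  let ?M = "uniform_bernoulli p"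
  have atom: "{x \<in> space ?M. (T ^^ i) x w = k i w} \<in> sets ?M" if w: "w \<in> W" for i w
  proof -
    have wV: "w \<in> cayley_vertices"
      using w W(2) by blast
    then have "(\<lambda>x. x w) \<in> measurable ?M (uniform_count_measure {0..<p})"
      unfolding uniform_bernoulli_def by (rule measurable_component_singleton)
    from measurable_compose[OF T_pow_measurable[OF T] this, of i]
    have preim: "(\<lambda>x. (T ^^ i) x w) -` ({k i w} \<inter> {0..<p}) \<inter> space ?M \<in> sets ?M"
      by (rule measurable_sets) (simp add: sets_uniform_count_measure)
    have "(\<lambda>x. (T ^^ i) x w) -` ({k i w} \<inter> {0..<p}) \<inter> space ?M =
        {x \<in> space ?M. (T ^^ i) x w = k i w}"
    proof -
      have "(T ^^ i) x w \<in> {k i w} \<inter> {0..<p} \<longleftrightarrow> (T ^^ i) x w = k i w"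
        if "x \<in> configurations p" for x
        using configuration_less[OF T_pow_in_configurations[OF that, of i] wV] by auto
      then show ?thesis
        unfolding space_uniform_bernoulli by blast
    qed
    with preim show ?thesis
      by (simp only:)
  qed
  have "{x \<in> space ?M. \<forall>w\<in>W. (T ^^ i) x w = k i w} \<in> sets ?M" for i
    using sets.sets_Collect_finite_All[of W ?M "\<lambda>w x. (T ^^ i) x w = k i w"] atom W(1) by blast
  then have "{x \<in> space ?M. \<forall>i\<in>{..<n}. \<forall>w\<in>W. (T ^^ i) x w = k i w} \<in> sets ?M"
    using sets.sets_Collect_finite_All[of "{..<n}" ?M "\<lambda>i x. \<forall>w\<in>W. (T ^^ i) x w = k i w"] by blast
  then show ?thesis
    unfolding space_uniform_bernoulli Ball_def lessThan_iff .
qed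

text \<open>By additivity, adding \<open>z\<close> maps the configurations with zero observation onto those that are
  observed like \<open>z\<close>, and it preserves the measure.\<close>

lemma observation_fibres_equidistributed:
  assumes T: "T \<in> measurable (uniform_bernoulli p) (uniform_bernoulli p)"
    and W: "finite W" "W \<subseteq> cayley_vertices" and z: "z \<in> configurations p"
  shows "measure (uniform_bernoulli p) {x \<in> configurations p. observation W n x = observation W n z} =
    measure (uniform_bernoulli p) {x \<in> configurations p. \<forall>i<n. \<forall>w\<in>W. (T ^^ i) x w = 0}"
proof -
  let ?M = "uniform_bernoulli p"
  let ?F = "{x \<in> configurations p. observation W n x = observation W n z}"
  have F: "?F \<in> sets ?M"
    unfolding observation_eq_iff using observation_fibre_measurable[OF T W] .
  have cancel: "(r + s) mod p = s \<longleftrightarrow> r = 0" if "r < p" "s < p" for r s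
    using that cong_add_rcancel_0_nat[of r s p] by (simp add: cong_def)
  have "(T ^^ i) (translate p z x) w = (T ^^ i) z w \<longleftrightarrow> (T ^^ i) x w = 0"
    if "x \<in> configurations p" "w \<in> W" for x i w
  proof -
    have w: "w \<in> cayley_vertices"
      using that W by auto
    then have "(T ^^ i) x w < p" "(T ^^ i) z w < p"
      using T_pow_in_configurations that(1) z by (auto intro: configuration_less)
    then show ?thesis
      using w cancel by (simp add: T_pow_translate translate_apply)
  qed
  then have "translate p z -` ?F \<inter> space ?M =
      {x \<in> configurations p. \<forall>i<n. \<forall>w\<in>W. (T ^^ i) x w = 0}"
    by (auto simp: observation_eq_iff space_uniform_bernoulli translate_in_configurations p_pos)
  then show ?thesis
    using measure_distr[OF measurable_translate[OF p_pos] F, of z] by (simp add: distr_translate p_pos)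
qed

definition window_partition :: "nat list set \<Rightarrow> (nat list \<Rightarrow> nat) set set" where
  "window_partition W = fibre_partition (\<lambda>x. restrict x W) (configurations p)"

lemma iterated_join_window_partition:
  assumes "n > 0"
  shows "iterated_join (uniform_bernoulli p) T (window_partition W) n =
    fibre_partition (observation W n) (configurations p)"
  using iterated_join_fibre_partition[of T "uniform_bernoulli p" n "\<lambda>x. restrict x W"] assms
    cayley_CA_in_configurations[OF p_pos]
  by (simp add: window_partition_def space_uniform_bernoulli observation_def[abs_def])

lemma window_partition_eq_observation:
  "window_partition W = fibre_partition (observation W 1) (configurations p)"
proof -
  have "restrict x W = restrict y W \<longleftrightarrow> observation W 1 x = observation W 1 y" for x y :: "nat list \<Rightarrow> nat"
    unfolding observation_eq_iff by (auto simp: restrict_def fun_eq_iff)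
  then show ?thesis
    by (simp only: window_partition_def fibre_partition_def)
qed

lemma observation_partition_measurable:
  assumes T: "T \<in> measurable (uniform_bernoulli p) (uniform_bernoulli p)"
    and W: "finite W" "W \<subseteq> cayley_vertices"
  shows "fibre_partition (observation W n) (configurations p) \<subseteq> sets (uniform_bernoulli p)"
  unfolding fibre_partition_def observation_eq_iff
  by (rule image_subsetI) (rule observation_fibre_measurable[OF T W])

lemma partition_entropy_observation:
  assumes T: "T \<in> measurable (uniform_bernoulli p) (uniform_bernoulli p)"
    and W: "finite W" "W \<subseteq> cayley_vertices" and level: "\<And>w. w \<in> W \<Longrightarrow> length w = l" "l \<ge> 1"
  shows "partition_entropy (uniform_bernoulli p) (fibre_partition (observation W n) (configurations p)) =
    ennreal (n * (card W * log 2 p))"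
proof -
  interpret prob_space "uniform_bernoulli p"
    by (rule prob_space_uniform_bernoulli[OF p_pos])
  let ?\<alpha> = "fibre_partition (observation W n) (configurations p)"
  have "partition_entropy (uniform_bernoulli p) ?\<alpha> = ennreal (log 2 (card ?\<alpha>))"
  proof (rule partition_entropy_equidistributed)
    show "partition_on (space (uniform_bernoulli p)) ?\<alpha>"
      by (simp add: space_uniform_bernoulli partition_on_fibre_partition)
    show "finite ?\<alpha>"
      by (intro finite_fibre_partition card_observation_image(2)[OF W level])
    show "?\<alpha> \<subseteq> sets (uniform_bernoulli p)"
      by (rule observation_partition_measurable[OF T W])
    show "prob A = prob {x \<in> configurations p. \<forall>i<n. \<forall>w\<in>W. (T ^^ i) x w = 0}" if "A \<in> ?\<alpha>" for A
      using that observation_fibres_equidistributed[OF T W] by (auto simp: fibre_partition_def)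
  qed
  also have "log 2 (card ?\<alpha>) = n * (card W * log 2 p)"
    using p_pos by (simp add: card_fibre_partition card_observation_image(1)[OF W level] log_nat_power mult_ac)
  finally show ?thesis .
qed

lemma entropy_wrt_window_partition:
  assumes T: "T \<in> measurable (uniform_bernoulli p) (uniform_bernoulli p)"
    and W: "finite W" "W \<subseteq> cayley_vertices" and level: "\<And>w. w \<in> W \<Longrightarrow> length w = l" "l \<ge> 1"
  shows "entropy_wrt_partition (uniform_bernoulli p) T (window_partition W) = ennreal (card W * log 2 p)"
proof -
  \<comment> \<open>The quotients are constant, so the limit exists without any appeal to subadditivity.\<close>
  have "partition_entropy (uniform_bernoulli p) (iterated_join (uniform_bernoulli p) T (window_partition W) n)
      / of_nat n = ennreal (card W * log 2 p)" if "n > 0" for n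
    using that p_gt_1
    by (simp add: iterated_join_window_partition partition_entropy_observation[OF assms]
        ennreal_of_nat_eq_real_of_nat divide_ennreal)
  then have "\<forall>\<^sub>F n in sequentially. partition_entropy (uniform_bernoulli p)
      (iterated_join (uniform_bernoulli p) T (window_partition W) n) / of_nat n = ennreal (card W * log 2 p)"
    by (intro eventually_mono[OF eventually_gt_at_top[of 0]])
  then show ?thesis
    unfolding entropy_wrt_partition_def by (intro limI tendsto_eventually)
qed

lemma window_partition_admissible:
  assumes T: "T \<in> measurable (uniform_bernoulli p) (uniform_bernoulli p)"
    and W: "finite W" "W \<subseteq> cayley_vertices" and level: "\<And>w. w \<in> W \<Longrightarrow> length w = l" "l \<ge> 1"
  shows "measurable_partition (uniform_bernoulli p) (window_partition W)"
    and "partition_entropy (uniform_bernoulli p) (window_partition W) < \<infinity>"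
proof -
  have "countable (window_partition W)"
    unfolding window_partition_eq_observation
    by (intro countable_finite finite_fibre_partition card_observation_image(2)[OF W level])
  then show "measurable_partition (uniform_bernoulli p) (window_partition W)"
    using observation_partition_measurable[OF T W, of 1]
    by (simp add: measurable_partition_def space_uniform_bernoulli window_partition_eq_observation
        partition_on_fibre_partition)
  show "partition_entropy (uniform_bernoulli p) (window_partition W) < \<infinity>"
    by (simp add: window_partition_eq_observation partition_entropy_observation[OF assms] del: One_nat_def)
qed

lemma measure_entropy_infinite:
  assumes T: "T \<in> measurable (uniform_bernoulli p) (uniform_bernoulli p)"
  shows "measure_entropy (uniform_bernoulli p) T = \<infinity>"
proof (rule ccontr)
  assume "measure_entropy (uniform_bernoulli p) T \<noteq> \<infinity>"
  then obtain k where k: "measure_entropy (uniform_bernoulli p) T < of_nat k"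
    using ennreal_Ex_less_of_nat by (auto simp: top.not_eq_extremum)
  \<comment> \<open>The subtree below a single child of the root is large enough: it has \<open>2 ^ k \<ge> k\<close> vertices on level \<open>k + 1\<close>.\<close>
  define W where "W = Cons 1 ` {u. set u \<subseteq> {1, 2::nat} \<and> length u = k}"
  have "finite {u. set u \<subseteq> {1, 2::nat} \<and> length u = k}"
    by (rule finite_lists_length_eq) simp
  then have fin: "finite W"
    unfolding W_def by (rule finite_imageI)
  have vert: "W \<subseteq> cayley_vertices"
    unfolding W_def cayley_vertices_def by blast
  have level: "length w = Suc k" if "w \<in> W" for w
    using that unfolding W_def by force
  have "Suc k \<ge> 1"
    by simp
  note W = fin vert level this
  have "card W = 2 ^ k"
    unfolding W_def by (simp add: card_image card_lists_length_eq numeral_2_eq_2)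
  then have "real k \<le> card W"
    using less_exp[of k] by linarith
  also have "real (card W) = real (card W) * 1"
    by simp
  also have "\<dots> \<le> card W * log 2 p"
  proof (rule mult_left_mono)
    show "1 \<le> log 2 p"
      using p_gt_1 by simp
  qed simp
  finally have "real k \<le> card W * log 2 p" .
  then have "of_nat k \<le> ennreal (card W * log 2 p)"
    by (simp add: ennreal_of_nat_eq_real_of_nat ennreal_leI)
  also have "\<dots> = entropy_wrt_partition (uniform_bernoulli p) T (window_partition W)"
    using entropy_wrt_window_partition[OF T W] by simp
  also have "\<dots> \<le> measure_entropy (uniform_bernoulli p) T"
    unfolding measure_entropy_def using window_partition_admissible[OF T W]
    by (intro SUP_upper) simp
  finally show False
    using k by simp
qed

end

theorem theorem5p4:
  fixes p a b c d :: nat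
  assumes "prime p"
    and "a \<in> {1..<p}" and "b \<in> {1..<p}" and "c \<in> {1..<p}" and "d \<in> {1..<p}"
    and "measure_preserving (uniform_bernoulli p) (cayley_CA p a b c d)"
  shows "measure_entropy (uniform_bernoulli p) (cayley_CA p a b c d) = \<infinity>"
proof -
  have "\<not> p dvd a"
    using \<open>a \<in> {1..<p}\<close> by (auto dest: dvd_imp_le)
  then have "coprime a p"
    using \<open>prime p\<close> by (metis prime_imp_coprime coprime_commute)
  with \<open>prime p\<close> interpret cayley_automaton p a b c d
    by unfold_locales (auto dest: prime_gt_1_nat)
  show ?thesis
    using \<open>measure_preserving _ _\<close> by (intro measure_entropy_infinite) (simp add: measure_preserving_def)
qed

end
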